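(* Let $F$ be Thompson's group, let $D$ be the set of all dyadic rational numbers in $(0,1)$, and let $\{d_1,\ldots,d_n\}\subset D$ be any finite subset. Then the subgroup $\mathrm{Stab}_F(d_1,\ldots,d_n)=\{f\in F : f(d_i)=d_i \text{ for all } i=1,\ldots,n\}$ is coamenable in $F$.
   Context: Thompson's group $F$ is the group of all strictly increasing piecewise linear homeomorphisms of $[0,1]$ that are differentiable except at finitely many dyadic rational numbers and whose derivatives on the intervals of differentiability are integer powers of $2$. Products are composed left to right: $(fg)(x)=g(f(x))$. $F$ is generated by $x_0,x_1$, where $x_0(t)=t/2$ on $[0,\frac12]$, $t-\frac14$ on $[\frac12,\frac34]$, $2t-1$ on $[\frac34,1]$; $x_1(t)=t$ on $[0,\frac12]$, $\frac t2+\frac14$ on $[\frac12,\frac34]$, $t-\frac18$ on $[\frac34,\frac78]$, $2t-1$ on $[\frac78,1]$. For a subgroup $H$ of a group $G$ with finite generating set $S$, the Schreier graph $\Gamma(G,S,H)$ has as vertices the right cosets $Hg$, with an arrow labelled $s\in S$ from $Hg$ to $Hgs$. For an infinite graph $\Gamma=(V,E)$ of bounded degree, the Cheeger constant is $h(\Gamma)=\inf_S |\partial S|/|S|$, where $S$ runs over all nonempty finite subsets of $V$ and $\partial S$ is the set of vertices of $V\setminus S$ that have a neighbor in $S$ (edge orientations and labels are ignored). $\Gamma$ is amenable if $h(\Gamma)=0$. A subgroup $H$ of a finitely generated group $G$ is coamenable in $G$ if the Schreier graph of $G$ with respect to $H$ is amenable (this does not depend on the finite generating set; for $F$ one may use $\{x_0,x_1\}$).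 *)

theory Defs
  imports "HOL-Analysis.Analysis" "HOL-Algebra.Coset" "Graph_Theory.Digraph"
begin

definition piecewise_linear_on :: "real \<Rightarrow> real \<Rightarrow> (real \<Rightarrow> real) \<Rightarrow> bool" where
  "piecewise_linear_on a b f \<longleftrightarrow>
     (\<exists>P. finite P \<and>
        (\<forall>u v. a \<le> u \<longrightarrow> u < v \<longrightarrow> v \<le> b \<longrightarrow> {u<..<v} \<inter> P = {} \<longrightarrow>
           (\<exists>m c. \<forall>x\<in>{u..v}. f x = m * x + c)))"

text \<open>
  Homeomorphisms of \<open>[0,1]\<close> are represented by functions that are undefined outside \<open>[0,1]\<close>.
  The library set \<^const>\<open>dyadics\<close> contains only the nonnegative dyadic rationals, which
  makes no difference inside \<open>[0,1]\<close>. Products are composed from left to right.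
\<close>

definition thompson_F :: "(real \<Rightarrow> real) monoid" where
  "thompson_F =
     \<lparr>carrier = {f. f \<in> extensional {0..1} \<and>
        (\<exists>g. homeomorphism {0..1} {0..1} f g) \<and>
        strict_mono_on {0..1} f \<and>
        piecewise_linear_on 0 1 f \<and>
        (\<exists>P. finite P \<and> P \<subseteq> dyadics \<and>
           (\<forall>x\<in>{0..1} - P. \<exists>k::int. (f has_real_derivative 2 powi k) (at x within {0..1})))},
      monoid.mult = (\<lambda>f g. compose {0..1} g f),
      one = (\<lambda>x\<in>{0..1}. x)\<rparr>"

definition x0 :: "real \<Rightarrow> real" where
  "x0 = (\<lambda>t\<in>{0..1}. if t \<le> 1/2 then t / 2 else if t \<le> 3/4 then t - 1/4 else 2 * t - 1)"

definition x1 :: "real \<Rightarrow> real" where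
  "x1 = (\<lambda>t\<in>{0..1}. if t \<le> 1/2 then t else if t \<le> 3/4 then t / 2 + 1/4
                    else if t \<le> 7/8 then t - 1/8 else 2 * t - 1)"

definition Stab_F :: "real set \<Rightarrow> (real \<Rightarrow> real) set" where
  "Stab_F A = {f \<in> carrier thompson_F. \<forall>d\<in>A. f d = d}"

text \<open>The pair \<open>(C, s)\<close> is the arrow labelled \<open>s\<close> that starts at the coset \<open>C\<close>.\<close>

definition schreier_graph ::
  "('a, 'b) monoid_scheme \<Rightarrow> 'a set \<Rightarrow> 'a set \<Rightarrow> ('a set, 'a set \<times> 'a) pre_digraph" where
  "schreier_graph G S H =
     \<lparr>verts = rcosets\<^bsub>G\<^esub> H, arcs = (rcosets\<^bsub>G\<^esub> H) \<times> S,
      tail = fst, head = (\<lambda>(C, s). C #>\<^bsub>G\<^esub> s)\<rparr>"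

definition vertex_boundary :: "('v, 'e) pre_digraph \<Rightarrow> 'v set \<Rightarrow> 'v set" where
  "vertex_boundary \<Gamma> A =
     {v \<in> verts \<Gamma> - A. \<exists>u\<in>A. (u, v) \<in> arcs_ends \<Gamma> \<or> (v, u) \<in> arcs_ends \<Gamma>}"

definition cheeger_constant :: "('v, 'e) pre_digraph \<Rightarrow> real" where
  "cheeger_constant \<Gamma> =
     (INF A \<in> {A. A \<subseteq> verts \<Gamma> \<and> finite A \<and> A \<noteq> {}}.
        real (card (vertex_boundary \<Gamma> A)) / real (card A))"

definition bounded_degree :: "('v, 'e) pre_digraph \<Rightarrow> bool" where
  "bounded_degree \<Gamma> \<longleftrightarrow>
     (\<exists>k. \<forall>v\<in>verts \<Gamma>. finite (in_arcs \<Gamma> v) \<and> finite (out_arcs \<Gamma> v) \<and>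
        in_degree \<Gamma> v + out_degree \<Gamma> v \<le> k)"

text \<open>
  Infinite graphs are not singled out: for a nonempty finite graph the set of all vertices has
  empty boundary, so the Cheeger constant is \<open>0\<close>. Bounded degree guarantees that all the
  boundaries counted by \<^const>\<open>card\<close> are finite.
\<close>

definition amenable_graph :: "('v, 'e) pre_digraph \<Rightarrow> bool" where
  "amenable_graph \<Gamma> \<longleftrightarrow> bounded_degree \<Gamma> \<and> cheeger_constant \<Gamma> = 0"

text \<open>
  \<open>S\<close> is meant to be a finite generating set of \<open>G\<close>; coamenability does not depend on its choice.
  Thompson's group is generated by \<^const>\<open>x0\<close> and \<^const>\<open>x1\<close>.
\<close>

definition coamenable_wrt :: "('a, 'b) monoid_scheme \<Rightarrow> 'a set \<Rightarrow> 'a set \<Rightarrow> bool" where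
  "coamenable_wrt G S H \<longleftrightarrow>
     group G \<and> subgroup H G \<and> finite S \<and> S \<subseteq> carrier G \<and>
     amenable_graph (schreier_graph G S H)"

end

theory Submission
  imports Defs
begin

text \<open>
  On \<open>[0,1/2]\<close> the map \<open>x1\<close> is the identity and \<open>x0\<close> is halving, and the powers of \<open>x0\<close> push every
  point of \<open>(0,1)\<close> into this interval. With \<open>H\<close> the stabilizer of a nonempty finite set, the cosets
  \<open>H x0^k\<close> with \<open>k\<close> large are therefore distinct and fixed by \<open>x1\<close>, so a segment of such cosets has
  at most two boundary vertices, whatever its length. That \<open>F\<close> is a group rests on the fact that
  its elements and their inverses map dyadic points to dyadic points.
\<close>

section \<open>Dyadic numbers\<close>

text \<open>The set \<open>dyadics\<close> has no negative elements. Allowing negative numerators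
  gives a ring, so differences of dyadic points can be formed without tracking signs.\<close>

definition signed_dyadics :: "real set" where
  "signed_dyadics = {of_int a / 2 ^ n | a n. True}"

lemma signed_dyadicsI: "of_int a / 2 ^ n \<in> signed_dyadics"
  by (auto simp: signed_dyadics_def)

lemma signed_dyadics_add:
  assumes "x \<in> signed_dyadics" "y \<in> signed_dyadics"
  shows "x + y \<in> signed_dyadics"
proof -
  obtain a m b n where "x = of_int a / 2 ^ m" "y = of_int b / 2 ^ n"
    using assms by (auto simp: signed_dyadics_def)
  then have "x + y = of_int (a * 2 ^ n + b * 2 ^ m) / 2 ^ (m + n)"
    by (simp add: add_divide_distrib power_add)
  then show ?thesis using signed_dyadicsI by metis
qed

lemma signed_dyadics_mult:
  assumes "x \<in> signed_dyadics" "y \<in> signed_dyadics"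
  shows "x * y \<in> signed_dyadics"
proof -
  obtain a m b n where "x = of_int a / 2 ^ m" "y = of_int b / 2 ^ n"
    using assms by (auto simp: signed_dyadics_def)
  then have "x * y = of_int (a * b) / 2 ^ (m + n)"
    by (simp add: power_add)
  then show ?thesis using signed_dyadicsI by metis
qed

lemma signed_dyadics_diff:
  assumes "x \<in> signed_dyadics" "y \<in> signed_dyadics"
  shows "x - y \<in> signed_dyadics"
  using signed_dyadics_add[OF assms(1) signed_dyadics_mult[OF signed_dyadicsI[of "-1" 0] assms(2)]]
  by simp

text \<open>Negative exponents are included, so slopes are units of the ring of dyadics. This lets
  dyadic points be followed both forwards and backwards along an affine piece.\<close>

lemma powi_2_signed_dyadics: "(2::real) powi k \<in> signed_dyadics"
proof (cases "k \<ge> 0")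
  case True
  then have "(2::real) powi k = of_int (2 ^ nat k) / 2 ^ 0"
    by (simp add: power_int_def)
  then show ?thesis using signed_dyadicsI by metis
next
  case False
  then have "(2::real) powi k = of_int 1 / 2 ^ nat (- k)"
    by (simp add: power_int_def field_simps)
  then show ?thesis using signed_dyadicsI by metis
qed

lemma dyadics_iff_signed: "x \<in> dyadics \<longleftrightarrow> 0 \<le> x \<and> x \<in> signed_dyadics" for x :: real
proof
  assume "x \<in> dyadics"
  then obtain m k where x: "x = of_nat m / 2 ^ k" by (auto simp: dyadics_def)
  then have "x = of_int (int m) / 2 ^ k" by simp
  then show "0 \<le> x \<and> x \<in> signed_dyadics"
    using x signed_dyadicsI by (metis divide_nonneg_nonneg of_nat_0_le_iff zero_le_numeral zero_le_power)
next
  assume x: "0 \<le> x \<and> x \<in> signed_dyadics"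
  then obtain a n where a: "x = of_int a / 2 ^ n" by (auto simp: signed_dyadics_def)
  with x have "a \<ge> 0" using divide_neg_pos[of "of_int a" "2 ^ n :: real"] by force
  then have "x = of_nat (nat a) / 2 ^ n" using a by simp
  then show "x \<in> dyadics" unfolding dyadics_def by blast
qed

lemma zero_dyadic: "(0::real) \<in> dyadics" and one_dyadic: "(1::real) \<in> dyadics"
  using signed_dyadicsI[of 0 0] signed_dyadicsI[of 1 0] by (auto simp: dyadics_iff_signed)

section \<open>Piecewise affine maps with dyadic breakpoints\<close>

text \<open>One dyadic set \<open>P\<close> serves both conditions of \<open>thompson_F\<close>: the
  break points of piecewise linearity, arbitrary reals there, and the dyadic exceptions to
  differentiability. The affine formula holds on the closed interval, so adjacent pieces agree at a
  common break point.\<close>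

definition dyadic_pieces :: "real set \<Rightarrow> (real \<Rightarrow> real) \<Rightarrow> bool" where
  "dyadic_pieces P f \<longleftrightarrow> finite P \<and> P \<subseteq> dyadics \<and>
     (\<forall>u v. 0 \<le> u \<longrightarrow> u < v \<longrightarrow> v \<le> 1 \<longrightarrow> {u<..<v} \<inter> P = {} \<longrightarrow>
        (\<exists>(k::int) c. \<forall>x\<in>{u..v}. f x = 2 powi k * x + c))"

lemma dyadic_piecesE:
  assumes "dyadic_pieces P f" "0 \<le> u" "u < v" "v \<le> 1" "{u<..<v} \<inter> P = {}"
  obtains k :: int and c where "\<And>x. u \<le> x \<Longrightarrow> x \<le> v \<Longrightarrow> f x = 2 powi k * x + c"
  using assms unfolding dyadic_pieces_def by (metis atLeastAtMost_iff)

text \<open>Derivatives within a nondegenerate closed interval are unique even at its end points.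
  Hence the slopes of affine pieces on either side of a point of differentiability can be
  compared.\<close>

lemma derivative_within_affine_eq:
  fixes f :: "real \<Rightarrow> real"
  assumes f: "(f has_real_derivative D) (at x within S)"
    and sub: "{u..v} \<subseteq> S" and "u < v" and x: "x \<in> {u..v}"
    and aff: "\<And>y. y \<in> {u..v} \<Longrightarrow> f y = m * y + c"
  shows "m = D"
proof -
  have 1: "(f has_real_derivative D) (at x within {u..v})"
    using f sub by (rule DERIV_subset)
  have "((\<lambda>y. m * y + c) has_real_derivative m) (at x within {u..v})"
    by (auto intro!: derivative_eq_intros)
  then have 2: "(f has_real_derivative m) (at x within {u..v})"
    by (rule has_field_derivative_transform_within[where d = 1]) (use x in \<open>simp_all add: aff\<close>)
  have "(f has_vector_derivative D) (at x within {u..v})"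
       "(f has_vector_derivative m) (at x within {u..v})"
    using 1 2 by (simp_all add: has_real_derivative_iff_has_vector_derivative)
  then show ?thesis
    using \<open>u < v\<close> x
    by (metis box_real(2) vector_derivative_unique_within_closed_interval)
qed

text \<open>A point of \<open>Q\<close> outside \<open>P\<close> is no real break: \<open>f\<close>
  is differentiable there, so the slopes on both sides agree, and the common value at the point
  makes the constants agree. Such points are removed by induction on their number inside the
  interval.\<close>

lemma affine_on_merge:
  fixes f :: "real \<Rightarrow> real"
  assumes Q: "finite Q" and "0 \<le> u" "u < v" "v \<le> 1" "{u<..<v} \<inter> P = {}"
    and lin: "\<And>u v. 0 \<le> u \<Longrightarrow> u < v \<Longrightarrow> v \<le> 1 \<Longrightarrow> {u<..<v} \<inter> Q = {} \<Longrightarrow>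
                \<exists>m c. \<forall>x\<in>{u..v}. f x = m * x + c"
    and der: "\<And>x. x \<in> {0..1} - P \<Longrightarrow> \<exists>k::int. (f has_real_derivative 2 powi k) (at x within {0..1})"
  shows "\<exists>(k::int) c. \<forall>x\<in>{u..v}. f x = 2 powi k * x + c"
  using assms(2-5)
proof (induction "card (Q \<inter> {u<..<v})" arbitrary: u v rule: less_induct)
  case less
  show ?case
  proof (cases "Q \<inter> {u<..<v} = {}")
    case True
    then obtain m c where mc: "\<And>x. x \<in> {u..v} \<Longrightarrow> f x = m * x + c"
      using lin[of u v] less.prems by blast
    \<comment> \<open>Any interior point would do: the derivative there forces the slope to be a
      power of 2.\<close>
    have "(u + v) / 2 \<in> {0..1} - P" using less.prems by (auto simp: disjoint_iff)
    then obtain k :: int where "(f has_real_derivative 2 powi k) (at ((u + v) / 2) within {0..1})"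
      using der by blast
    then have "m = 2 powi k"
      by (rule derivative_within_affine_eq[of _ _ _ _ u v _ c]) (use less.prems mc in auto)
    then show ?thesis using mc by blast
  next
    case False
    then obtain q where q: "q \<in> Q" "u < q" "q < v" by auto
    have l: "card (Q \<inter> {u<..<q}) < card (Q \<inter> {u<..<v})"
      by (rule psubset_card_mono) (use Q q in auto)
    have r: "card (Q \<inter> {q<..<v}) < card (Q \<inter> {u<..<v})"
      by (rule psubset_card_mono) (use Q q in auto)
    obtain k c where 1: "\<And>x. x \<in> {u..q} \<Longrightarrow> f x = 2 powi (k::int) * x + c"
      using less.hyps[OF l] less.prems q by (force simp: disjoint_iff)
    obtain l d where 2: "\<And>x. x \<in> {q..v} \<Longrightarrow> f x = 2 powi (l::int) * x + d"
      using less.hyps[OF r] less.prems q by (force simp: disjoint_iff)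
    have "q \<in> {0..1} - P" using less.prems q by (auto simp: disjoint_iff)
    then obtain D where D: "(f has_real_derivative D) (at q within {0..1})"
      using der by blast
    have "2 powi k = D"
      by (rule derivative_within_affine_eq[OF D, of u q _ c]) (use less.prems q 1 in auto)
    moreover have "2 powi l = D"
      by (rule derivative_within_affine_eq[OF D, of q v _ d]) (use less.prems q 2 in auto)
    ultimately have e: "2 powi l = (2 powi k :: real)" by simp
    have "c = d" using 1[of q] 2[of q] q e by simp
    then have "f x = 2 powi k * x + c" if "x \<in> {u..v}" for x
      using 1[of x] 2[of x] e that by (cases "x \<le> q") auto
    then show ?thesis by blast
  qed
qed

text \<open>The finite set \<open>P\<close> is closed, so a point outside it has a neighbourhood on
  which a single affine formula holds. The end points 0 and 1 have no two-sided neighbourhood in the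
  interval and are left out.\<close>

lemma dyadic_pieces_derivative:
  assumes f: "dyadic_pieces P f" and x: "x \<in> {0<..<1} - P"
  shows "\<exists>k::int. (f has_real_derivative 2 powi k) (at x within {0..1})"
proof -
  have "open ({0<..<1} - P)"
    using f by (auto simp: dyadic_pieces_def finite_imp_closed open_Diff)
  then obtain e where e: "e > 0" "ball x e \<subseteq> {0<..<1} - P"
    using x open_contains_ball by blast
  \<comment> \<open>Half the radius keeps the closed interval, end points included, inside the open
    ball.\<close>
  define u v where "u = x - e / 2" and "v = x + e / 2"
  have b: "{u..v} \<subseteq> ball x e" using e by (auto simp: u_def v_def dist_real_def)
  have uv: "u < x" "x < v" using e by (auto simp: u_def v_def)
  then have uv01: "u \<in> {0<..<1} - P" "v \<in> {0<..<1} - P"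
    using subsetD[OF b, of u] subsetD[OF b, of v] e by auto
  obtain k c where kc: "\<And>y. u \<le> y \<Longrightarrow> y \<le> v \<Longrightarrow> f y = 2 powi (k::int) * y + c"
  proof (rule dyadic_piecesE[OF f, of u v])
    have "{u<..<v} \<subseteq> {0<..<1} - P"
      using b e greaterThanLessThan_subseteq_atLeastAtMost_iff[of u v u v] by blast
    then show "{u<..<v} \<inter> P = {}" by blast
  qed (use uv uv01 in auto)
  have "((\<lambda>y. 2 powi k * y + c) has_real_derivative 2 powi k) (at x)"
    by (auto intro!: derivative_eq_intros)
  then have "(f has_real_derivative 2 powi k) (at x)"
    by (rule has_field_derivative_transform_within_open[where S = "{u<..<v}"]) (use uv kc in auto)
  then show ?thesis using has_field_derivative_at_within by blast
qed

text \<open>The last break point \<open>q\<close> before \<open>x\<close>; if there is none, \<open>q = 0\<close>.\<close>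

lemma dyadic_pieces_last_break:
  assumes f: "dyadic_pieces P f" and x: "0 < x" "x \<le> 1"
  obtains q k where "q \<in> dyadics" "0 \<le> q" "q < x" "q \<in> insert 0 P"
    "f x = f q + 2 powi (k::int) * (x - q)"
proof -
  define B where "B = {p \<in> insert 0 P. 0 \<le> p \<and> p < x}"
  have B: "finite B" "B \<noteq> {}" using f x by (auto simp: B_def dyadic_pieces_def)
  define q where "q = Max B"
  have q: "q \<in> B" using B by (simp add: q_def)
  have "{q<..<x} \<inter> P = {}"
  proof (rule ccontr)
    assume "{q<..<x} \<inter> P \<noteq> {}"
    then obtain p where p: "p \<in> P" "q < p" "p < x" by auto
    then have "p \<in> B" using q by (auto simp: B_def)
    then show False using p B Max_ge[of B p] unfolding q_def by linarith
  qed
  then obtain k c where kc: "\<And>y. q \<le> y \<Longrightarrow> y \<le> x \<Longrightarrow> f y = 2 powi (k::int) * y + c"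
    using q x by (auto simp: B_def intro: dyadic_piecesE[OF f, of q x])
  show thesis
  proof (rule that[of q k])
    show "f x = f q + 2 powi k * (x - q)"
      using kc[of x] kc[of q] q by (auto simp: B_def algebra_simps)
  qed (use q f zero_dyadic in \<open>auto simp: B_def dyadic_pieces_def\<close>)
qed

text \<open>Induction on the number of break points, with 0 among them, to the left of
  \<open>x\<close>. The value at \<open>x\<close> differs from the value at the last break
  \<open>q\<close> by a power of 2 times the dyadic number \<open>x - q\<close>, and the fixed point
  0 starts the induction.\<close>

lemma dyadic_pieces_image_dyadic:
  assumes f: "dyadic_pieces P f" and f0: "f 0 = 0"
    and "x \<in> signed_dyadics" "0 \<le> x" "x \<le> 1"
  shows "f x \<in> signed_dyadics"
  using assms(3-5)
proof (induction "card (insert 0 P \<inter> {..<x})" arbitrary: x rule: less_induct)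
  case less
  show ?case
  proof (cases "x = 0")
    case True
    then show ?thesis using f0 less.prems by simp
  next
    case False
    then obtain q k where q: "q \<in> dyadics" "0 \<le> q" "q < x" "q \<in> insert 0 P"
      "f x = f q + 2 powi (k::int) * (x - q)"
      using dyadic_pieces_last_break[OF f, of x] less.prems by auto
    \<comment> \<open>The point \<open>q\<close> itself is counted to the left of \<open>x\<close>
      but not to the left of \<open>q\<close>.\<close>
    have "card (insert 0 P \<inter> {..<q}) < card (insert 0 P \<inter> {..<x})"
      by (rule psubset_card_mono) (use f q in \<open>auto simp: dyadic_pieces_def\<close>)
    then have "f q \<in> signed_dyadics"
      using less q by (auto simp: dyadics_iff_signed)
    then show ?thesis
      using q less.prems
      by (auto simp: dyadics_iff_signed
          intro!: signed_dyadics_add signed_dyadics_mult signed_dyadics_diff powi_2_signed_dyadics)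
  qed
qed

text \<open>The affine formula from the last break point is solved for \<open>x\<close>; the
  reciprocal of the slope is again a power of 2.\<close>

lemma dyadic_pieces_preimage_dyadic:
  assumes f: "dyadic_pieces P f" and f0: "f 0 = 0"
    and x: "f x \<in> signed_dyadics" "0 \<le> x" "x \<le> 1"
  shows "x \<in> signed_dyadics"
proof (cases "x = 0")
  case True
  then show ?thesis using f0 x by simp
next
  case False
  obtain q k where q: "q \<in> dyadics" "0 \<le> q" "q < x"
    "f x = f q + 2 powi (k::int) * (x - q)"
    by (rule dyadic_pieces_last_break[OF f, of x]) (use x False in auto)
  then have "f q \<in> signed_dyadics"
    using dyadic_pieces_image_dyadic[OF f f0, of q] x by (auto simp: dyadics_iff_signed)
  moreover have "x = q + 2 powi (- k) * (f x - f q)"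
    using q by (simp add: power_int_minus field_simps)
  ultimately show ?thesis
    using q x
    by (metis dyadics_iff_signed signed_dyadics_add signed_dyadics_mult signed_dyadics_diff
        powi_2_signed_dyadics)
qed

section \<open>Thompson's group\<close>

text \<open>Break points and slopes are now held by one predicate, which is easy to carry through
  composition and inversion. Forwards, spurious break points are merged away; backwards, derivatives
  are read off the pieces.\<close>

lemma carrier_thompson_F_iff:
  "f \<in> carrier thompson_F \<longleftrightarrow> f \<in> extensional {0..1} \<and>
     (\<exists>g. homeomorphism {0..1} {0..1} f g) \<and> strict_mono_on {0..1} f \<and>
     (\<exists>P. dyadic_pieces P f)" (is "?L \<longleftrightarrow> ?R")
proof
  assume L: ?L
  then obtain P where P: "finite P" "P \<subseteq> dyadics"
    "\<And>x. x \<in> {0..1} - P \<Longrightarrow> \<exists>k::int. (f has_real_derivative 2 powi k) (at x within {0..1})"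
    by (auto simp: thompson_F_def)
  from L obtain Q where Q: "finite Q"
    "\<And>u v. 0 \<le> u \<Longrightarrow> u < v \<Longrightarrow> v \<le> 1 \<Longrightarrow> {u<..<v} \<inter> Q = {} \<Longrightarrow>
       \<exists>m c. \<forall>x\<in>{u..v}. f x = m * x + c"
    by (auto simp: thompson_F_def piecewise_linear_on_def)
  have "dyadic_pieces P f"
    unfolding dyadic_pieces_def using P(1,2) affine_on_merge[OF Q(1) _ _ _ _ Q(2) P(3)] by blast
  then show ?R using L by (auto simp: thompson_F_def)
next
  assume R: ?R
  then obtain P where P: "dyadic_pieces P f" by blast
  then have "piecewise_linear_on 0 1 f"
    unfolding piecewise_linear_on_def dyadic_pieces_def by meson
  \<comment> \<open>Derivatives are known only in the open interval; 0 and 1 are dyadic and may join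
    the exceptions.\<close>
  moreover have "\<forall>x\<in>{0..1} - (P \<union> {0, 1}). \<exists>k::int. (f has_real_derivative 2 powi k) (at x within {0..1})"
    using dyadic_pieces_derivative[OF P] by (simp add: less_le)
  moreover have "finite (P \<union> {0, 1})" "P \<union> {0, 1} \<subseteq> dyadics"
    using P zero_dyadic one_dyadic by (auto simp: dyadic_pieces_def)
  ultimately have "piecewise_linear_on 0 1 f" "\<exists>P. finite P \<and> P \<subseteq> dyadics \<and>
      (\<forall>x\<in>{0..1} - P. \<exists>k::int. (f has_real_derivative 2 powi k) (at x within {0..1}))"
    by blast+
  then show ?L using R by (simp add: thompson_F_def)
qed

lemma thompson_F_strict_mono: "f \<in> carrier thompson_F \<Longrightarrow> strict_mono_on {0..1} f"
  by (simp add: carrier_thompson_F_iff)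

lemma thompson_F_image: "f \<in> carrier thompson_F \<Longrightarrow> f ` {0..1} = {0..1}"
  by (auto simp: carrier_thompson_F_iff homeomorphism_def)

lemma thompson_F_range: "f \<in> carrier thompson_F \<Longrightarrow> x \<in> {0..1} \<Longrightarrow> f x \<in> {0..1}"
  using thompson_F_image by blast

lemma thompson_F_less_iff:
  "f \<in> carrier thompson_F \<Longrightarrow> x \<in> {0..1} \<Longrightarrow> y \<in> {0..1} \<Longrightarrow> f x < f y \<longleftrightarrow> x < y"
  using strict_mono_on_less thompson_F_strict_mono by blast

lemma thompson_F_inj: "f \<in> carrier thompson_F \<Longrightarrow> inj_on f {0..1}"
  using strict_mono_on_imp_inj_on thompson_F_strict_mono by blast

lemma thompson_F_0:
  assumes f: "f \<in> carrier thompson_F" shows "f 0 = 0"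
proof -
  obtain x where x: "x \<in> {0..1}" "f x = 0"
    using thompson_F_image[OF f] by (metis atLeastAtMost_iff imageE order_refl zero_le_one)
  then show ?thesis
    using thompson_F_less_iff[OF f, of 0 x] thompson_F_range[OF f, of 0] by (cases "x = 0") auto
qed

section \<open>The group axioms for Thompson's group\<close>

lemma mult_thompson_F: "f \<otimes>\<^bsub>thompson_F\<^esub> g = compose {0..1} g f"
  by (simp add: thompson_F_def)

lemma one_thompson_F: "\<one>\<^bsub>thompson_F\<^esub> = (\<lambda>x\<in>{0..1}. x)"
  by (simp add: thompson_F_def)

lemma homeomorphism_restrict:
  assumes "homeomorphism S T f g"
  shows "homeomorphism S T (restrict f S) (restrict g T)"
  using assms by (auto simp: homeomorphism_def cong: continuous_on_cong_simp)

text \<open>The composite can break only at break points of \<open>f\<close> and at preimages under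
  \<open>f\<close> of break points of \<open>g\<close>. The latter are dyadic by
  \<open>dyadic_pieces_preimage_dyadic\<close>, and the exponents of the slopes add.\<close>

lemma thompson_F_mult_closed:
  assumes f: "f \<in> carrier thompson_F" and g: "g \<in> carrier thompson_F"
  shows "compose {0..1} g f \<in> carrier thompson_F"
proof -
  obtain f' g' where "homeomorphism {0..1} {0..1} f f'" "homeomorphism {0..1} {0..1} g g'"
    using f g by (auto simp: carrier_thompson_F_iff)
  then have "homeomorphism {0..1} {0..1} (restrict (g \<circ> f) {0..1}) (restrict (f' \<circ> g') {0..1})"
    by (intro homeomorphism_restrict homeomorphism_compose)
  then have hom: "\<exists>h. homeomorphism {0..1} {0..1} (compose {0..1} g f) h"
    by (auto simp: compose_def comp_def)
  have mono: "strict_mono_on {0..1} (compose {0..1} g f)"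
    using f g thompson_F_range by (simp add: strict_mono_on_def compose_def thompson_F_less_iff)
  obtain P Q where P: "dyadic_pieces P f" and Q: "dyadic_pieces Q g"
    using f g by (auto simp: carrier_thompson_F_iff)
  \<comment> \<open>Injectivity of \<open>f\<close> holds on the unit interval, so the preimage is
    cut down to it to be finite.\<close>
  define R where "R = P \<union> (f -` Q \<inter> {0..1})"
  have "dyadic_pieces R (compose {0..1} g f)"
    unfolding dyadic_pieces_def
  proof (intro conjI allI impI)
    show "finite R"
      using P Q finite_vimage_IntI[OF _ thompson_F_inj[OF f]] by (auto simp: R_def dyadic_pieces_def)
    show "R \<subseteq> dyadics"
      using P Q dyadic_pieces_preimage_dyadic[OF P thompson_F_0[OF f]]
      by (auto simp: R_def dyadic_pieces_def dyadics_iff_signed subset_iff)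
  next
    fix u v :: real
    assume uv: "0 \<le> u" "u < v" "v \<le> 1" "{u<..<v} \<inter> R = {}"
    then have "{u<..<v} \<inter> P = {}" by (auto simp: R_def)
    then obtain k c where kc: "\<And>x. u \<le> x \<Longrightarrow> x \<le> v \<Longrightarrow> f x = 2 powi (k::int) * x + c"
      using dyadic_piecesE[OF P uv(1-3)] by metis
    have "{f u<..<f v} \<inter> Q = {}"
    proof (rule ccontr)
      assume "{f u<..<f v} \<inter> Q \<noteq> {}"
      then obtain y where y: "f u < y" "y < f v" "y \<in> Q" by auto
      have "y \<in> {0..1}"
        using y thompson_F_range[OF f, of u] thompson_F_range[OF f, of v] uv by auto
      then obtain x where x: "x \<in> {0..1}" "y = f x" using thompson_F_image[OF f] by blast
      then have "u < x" "x < v" using y thompson_F_less_iff[OF f] uv by auto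
      then show False using uv x y by (auto simp: R_def disjoint_iff)
    qed
    then obtain l d where ld: "\<And>x. f u \<le> x \<Longrightarrow> x \<le> f v \<Longrightarrow> g x = 2 powi (l::int) * x + d"
      using dyadic_piecesE[OF Q, of "f u" "f v"] thompson_F_less_iff[OF f, of u v]
        thompson_F_range[OF f, of u] thompson_F_range[OF f, of v] uv
      by (metis atLeastAtMost_iff less_imp_le order_trans)
    have "compose {0..1} g f x = 2 powi (l + k) * x + (2 powi l * c + d)" if x: "x \<in> {u..v}" for x
    proof -
      have "f u \<le> f x" "f x \<le> f v"
        using thompson_F_less_iff[OF f, of x u] thompson_F_less_iff[OF f, of v x] uv x by auto
      then have "g (f x) = 2 powi l * (2 powi k * x + c) + d"
        using ld[of "f x"] kc[of x] x by simp
      then show ?thesis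
        using x uv by (simp add: compose_def power_int_add algebra_simps)
    qed
    then show "\<exists>k c. \<forall>x\<in>{u..v}. compose {0..1} g f x = 2 powi k * x + c" by blast
  qed
  then show ?thesis using hom mono by (auto simp: carrier_thompson_F_iff)
qed

lemma thompson_F_one_closed: "(\<lambda>x\<in>{0..1}. x) \<in> carrier thompson_F"
proof -
  have "homeomorphism {0..1} {0..1} (restrict id {0..1}) (restrict id {0..1::real})"
    by (intro homeomorphism_restrict homeomorphism_ident[unfolded id_def[symmetric]])
  moreover have "dyadic_pieces {} (\<lambda>x\<in>{0..1}. x)"
    unfolding dyadic_pieces_def by (auto intro!: exI[of _ 0])
  ultimately show ?thesis
    by (auto simp: carrier_thompson_F_iff strict_mono_on_def id_def)
qed

text \<open>The inverse breaks at images of break points of \<open>f\<close>, which are dyadic by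
  \<open>dyadic_pieces_image_dyadic\<close>, and has reciprocal slopes. Since products run from left
  to right, the equation makes \<open>g\<close> a left inverse, as \<open>groupI\<close>
  asks.\<close>

lemma thompson_F_inverse:
  assumes f: "f \<in> carrier thompson_F"
  shows "\<exists>g\<in>carrier thompson_F. compose {0..1} f g = (\<lambda>x\<in>{0..1}. x)"
proof -
  obtain g' where "homeomorphism {0..1} {0..1} f g'"
    using f by (auto simp: carrier_thompson_F_iff)
  then have "homeomorphism {0..1} {0..1} (restrict f {0..1}) (restrict g' {0..1})"
    by (rule homeomorphism_restrict)
  \<comment> \<open>The values of \<open>g'\<close> outside the interval are arbitrary; restriction
    makes the inverse extensional.\<close>
  moreover define g where "g = restrict g' {0..1}"
  moreover have "restrict f {0..1} = f"
    using f by (simp add: carrier_thompson_F_iff extensional_restrict)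
  ultimately have hom: "homeomorphism {0..1} {0..1} f g" by simp
  have g: "g x \<in> {0..1}" "f (g x) = x" if "x \<in> {0..1}" for x
    using hom that by (auto simp: homeomorphism_def)
  have less: "g x < g y \<longleftrightarrow> x < y" if "x \<in> {0..1}" "y \<in> {0..1}" for x y
    using thompson_F_less_iff[OF f, of "g x" "g y"] g that by simp
  obtain P where P: "dyadic_pieces P f"
    using f by (auto simp: carrier_thompson_F_iff)
  define R where "R = f ` (P \<inter> {0..1})"
  have "dyadic_pieces R g"
    unfolding dyadic_pieces_def
  proof (intro conjI allI impI)
    show "finite R" using P by (auto simp: R_def dyadic_pieces_def)
    show "R \<subseteq> dyadics"
      using P dyadic_pieces_image_dyadic[OF P thompson_F_0[OF f]] thompson_F_range[OF f]
      by (auto simp: R_def dyadic_pieces_def dyadics_iff_signed subset_iff)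
  next
    fix u v :: real
    assume uv: "0 \<le> u" "u < v" "v \<le> 1" "{u<..<v} \<inter> R = {}"
    have gu: "0 \<le> g u" "g u < g v" "g v \<le> 1" using g[of u] g[of v] less[of u v] uv by auto
    have "{g u<..<g v} \<inter> P = {}"
    proof (rule ccontr)
      assume "{g u<..<g v} \<inter> P \<noteq> {}"
      then obtain y where y: "g u < y" "y < g v" "y \<in> P" by auto
      then have y01: "y \<in> {0..1}" using gu by auto
      then have "u < f y" "f y < v"
        using y gu g[of u] g[of v] thompson_F_less_iff[OF f, of "g u" y]
          thompson_F_less_iff[OF f, of y "g v"] uv by auto
      then show False using uv y y01 by (auto simp: R_def disjoint_iff)
    qed
    then obtain k c where kc: "\<And>x. g u \<le> x \<Longrightarrow> x \<le> g v \<Longrightarrow> f x = 2 powi (k::int) * x + c"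
      using dyadic_piecesE[OF P gu] by metis
    have "g x = 2 powi (- k) * x + (- c * 2 powi (- k))" if x: "x \<in> {u..v}" for x
    proof -
      have "g u \<le> g x" "g x \<le> g v"
        using less[of x u] less[of v x] uv x by auto
      then have "x = 2 powi k * g x + c"
        using kc[of "g x"] g[of x] x uv by auto
      then show ?thesis by (simp add: power_int_minus field_simps)
    qed
    then show "\<exists>k c. \<forall>x\<in>{u..v}. g x = 2 powi k * x + c" by blast
  qed
  moreover have "homeomorphism {0..1} {0..1} g f" using hom by (rule homeomorphism_symD)
  moreover have "strict_mono_on {0..1} g" using less by (auto simp: strict_mono_on_def)
  moreover have "g \<in> extensional {0..1}" by (simp add: g_def)
  ultimately have "g \<in> carrier thompson_F" by (auto simp: carrier_thompson_F_iff)
  moreover have "compose {0..1} f g = (\<lambda>x\<in>{0..1}. x)"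
    using g by (auto simp: compose_def)
  ultimately show ?thesis by blast
qed

lemma group_thompson_F: "group thompson_F"
proof (rule groupI)
  fix f g h
  assume f: "f \<in> carrier thompson_F" and "g \<in> carrier thompson_F" "h \<in> carrier thompson_F"
  show "f \<otimes>\<^bsub>thompson_F\<^esub> g \<otimes>\<^bsub>thompson_F\<^esub> h = f \<otimes>\<^bsub>thompson_F\<^esub> (g \<otimes>\<^bsub>thompson_F\<^esub> h)"
    using thompson_F_range[OF f] by (auto simp: mult_thompson_F compose_def)
next
  fix f assume f: "f \<in> carrier thompson_F"
  show "\<one>\<^bsub>thompson_F\<^esub> \<otimes>\<^bsub>thompson_F\<^esub> f = f"
    using f by (auto simp: mult_thompson_F one_thompson_F compose_def carrier_thompson_F_iff
        extensional_def)
  show "\<exists>g\<in>carrier thompson_F. g \<otimes>\<^bsub>thompson_F\<^esub> f = \<one>\<^bsub>thompson_F\<^esub>"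
    using thompson_F_inverse[OF f] by (simp add: mult_thompson_F one_thompson_F)
qed (simp_all add: mult_thompson_F one_thompson_F thompson_F_mult_closed thompson_F_one_closed)

section \<open>Membership of the generators in Thompson's group\<close>

lemma thompson_F_memI:
  assumes ext: "f \<in> extensional {0..1}" and cont: "continuous_on {0..1} f"
    and mono: "strict_mono_on {0..1} f" and "f 0 = 0" "f 1 = 1" and P: "dyadic_pieces P f"
  shows "f \<in> carrier thompson_F"
proof -
  have "f ` {0..1} = {0..1}"
  proof
    show "f ` {0..1} \<subseteq> {0..1}"
    proof
      fix y assume "y \<in> f ` {0..1}"
      then obtain x where "x \<in> {0..1}" "y = f x" by blast
      then show "y \<in> {0..1}"
        using strict_mono_on_leD[OF mono, of 0 x] strict_mono_on_leD[OF mono, of x 1] assms(4,5)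
        by auto
    qed
    show "{0..1} \<subseteq> f ` {0..1}"
      using IVT'[of f 0 _ 1] assms(4,5) cont by (force simp: image_iff)
  qed
  then obtain g where "homeomorphism {0..1} {0..1} f g"
    using homeomorphism_compact[OF compact_Icc cont _ strict_mono_on_imp_inj_on[OF mono]] by blast
  then show ?thesis using assms by (auto simp: carrier_thompson_F_iff)
qed

lemma x0_in_thompson_F: "x0 \<in> carrier thompson_F"
proof (rule thompson_F_memI)
  \<comment> \<open>The slopes 1/2, 1, 2 increase, so \<open>x0\<close> is convex and equals the
    maximum of its affine pieces; no gluing argument is needed.\<close>
  have "continuous_on {0..1} (\<lambda>t::real. max (t / 2) (max (t - 1/4) (2 * t - 1)))"
    by (intro continuous_intros) auto
  then show "continuous_on {0..1} x0"
    by (rule continuous_on_eq) (auto simp: x0_def max_def)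
  show "dyadic_pieces {1/2, 3/4} x0"
    unfolding dyadic_pieces_def
  proof (intro conjI allI impI)
    show "{1/2, 3/4::real} \<subseteq> dyadics"
      using signed_dyadicsI[of 1 1] signed_dyadicsI[of 3 2] by (simp add: dyadics_iff_signed)
  next
    fix u v :: real
    assume uv: "0 \<le> u" "u < v" "v \<le> 1" "{u<..<v} \<inter> {1/2, 3/4} = {}"
    then consider "v \<le> 1/2" | "1/2 \<le> u" "v \<le> 3/4" | "3/4 \<le> u" by fastforce
    then show "\<exists>k c. \<forall>x\<in>{u..v}. x0 x = 2 powi k * x + c"
    proof cases
      case 1
      then show ?thesis using uv by (intro exI[of _ "-1"] exI[of _ 0]) (auto simp: x0_def power_int_minus)
    next
      case 2
      then show ?thesis using uv by (intro exI[of _ 0] exI[of _ "-1/4"]) (auto simp: x0_def)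
    next
      case 3
      then show ?thesis using uv by (intro exI[of _ 1] exI[of _ "-1"]) (auto simp: x0_def)
    qed
  qed simp
qed (auto simp: x0_def strict_mono_on_def)

lemma x1_in_thompson_F: "x1 \<in> carrier thompson_F"
proof (rule thompson_F_memI)
  \<comment> \<open>The slope drops from 1 to 1/2 at 1/2, so the first two pieces combine by a
    minimum; at 3/4 and 7/8 it rises, and maxima take over.\<close>
  have "continuous_on {0..1} (\<lambda>t::real. max (min t (t / 2 + 1/4)) (max (t - 1/8) (2 * t - 1)))"
    by (intro continuous_intros) auto
  then show "continuous_on {0..1} x1"
    by (rule continuous_on_eq) (auto simp: x1_def max_def min_def)
  show "dyadic_pieces {1/2, 3/4, 7/8} x1"
    unfolding dyadic_pieces_def
  proof (intro conjI allI impI)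
    show "{1/2, 3/4, 7/8::real} \<subseteq> dyadics"
      using signed_dyadicsI[of 1 1] signed_dyadicsI[of 3 2] signed_dyadicsI[of 7 3]
      by (simp add: dyadics_iff_signed)
  next
    fix u v :: real
    assume uv: "0 \<le> u" "u < v" "v \<le> 1" "{u<..<v} \<inter> {1/2, 3/4, 7/8} = {}"
    then consider "v \<le> 1/2" | "1/2 \<le> u" "v \<le> 3/4" | "3/4 \<le> u" "v \<le> 7/8" | "7/8 \<le> u"
      by fastforce
    then show "\<exists>k c. \<forall>x\<in>{u..v}. x1 x = 2 powi k * x + c"
    proof cases
      case 1
      then show ?thesis using uv by (intro exI[of _ 0] exI[of _ 0]) (auto simp: x1_def)
    next
      case 2
      then show ?thesis using uv by (intro exI[of _ "-1"] exI[of _ "1/4"]) (auto simp: x1_def power_int_minus)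
    next
      case 3
      then show ?thesis using uv by (intro exI[of _ 0] exI[of _ "-1/8"]) (auto simp: x1_def)
    next
      case 4
      then show ?thesis using uv by (intro exI[of _ 1] exI[of _ "-1"]) (auto simp: x1_def)
    qed
  qed simp
qed (auto simp: x1_def strict_mono_on_def)

section \<open>Schreier graphs\<close>

lemma (in group) rcosets_subset_carrier:
  "subgroup H G \<Longrightarrow> C \<in> rcosets H \<Longrightarrow> C \<subseteq> carrier G"
  using subgroup.rcosets_carrier is_group by blast

lemma (in group) r_coset_cancel:
  assumes "C \<subseteq> carrier G" "g \<in> carrier G"
  shows "C #> g = D \<Longrightarrow> C = D #> inv g"
  using assms by (auto simp: coset_mult_assoc)

text \<open>Right multiplication by a group element permutes the cosets, so each label contributes
  at most one incoming and one outgoing arc at a vertex.\<close>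

lemma (in group) bounded_degree_schreier_graph:
  assumes H: "subgroup H G" and S: "finite S" "S \<subseteq> carrier G"
  shows "bounded_degree (schreier_graph G S H)"
  unfolding bounded_degree_def
proof (intro exI ballI)
  let ?\<Gamma> = "schreier_graph G S H"
  fix v assume v: "v \<in> verts ?\<Gamma>"
  have i: "in_arcs ?\<Gamma> v \<subseteq> (\<lambda>s. (v #> inv s, s)) ` S"
  proof
    fix e assume "e \<in> in_arcs ?\<Gamma> v"
    then obtain C s where e: "e = (C, s)" "C \<in> rcosets H" "s \<in> S" "C #> s = v"
      by (auto simp: in_arcs_def schreier_graph_def)
    then have "C = v #> inv s"
      using S(2) by (intro r_coset_cancel[OF rcosets_subset_carrier[OF H]]) auto
    then show "e \<in> (\<lambda>s. (v #> inv s, s)) ` S" using e by blast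
  qed
  have o: "out_arcs ?\<Gamma> v \<subseteq> Pair v ` S"
    by (auto simp: out_arcs_def schreier_graph_def)
  have "card (in_arcs ?\<Gamma> v) \<le> card S" "card (out_arcs ?\<Gamma> v) \<le> card S"
    using i o S(1) by (meson surj_card_le)+
  then show "finite (in_arcs ?\<Gamma> v) \<and> finite (out_arcs ?\<Gamma> v) \<and>
      in_degree ?\<Gamma> v + out_degree ?\<Gamma> v \<le> card S + card S"
    using i o S(1) finite_surj by (auto simp: in_degree_def out_degree_def)
qed

section \<open>Estimates of Cheeger constants\<close>

lemma cheeger_constant_le:
  assumes "A \<subseteq> verts \<Gamma>" "finite A" "A \<noteq> {}"
  shows "cheeger_constant \<Gamma> \<le> real (card (vertex_boundary \<Gamma> A)) / real (card A)"
  unfolding cheeger_constant_def using assms by (intro cINF_lower bdd_belowI[of _ 0]) auto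

lemma cheeger_constant_nonneg:
  assumes "verts \<Gamma> \<noteq> {}"
  shows "0 \<le> cheeger_constant \<Gamma>"
  unfolding cheeger_constant_def
proof (rule cINF_greatest)
  show "{A. A \<subseteq> verts \<Gamma> \<and> finite A \<and> A \<noteq> {}} \<noteq> {}"
    using assms by (auto simp: ex_in_conv[symmetric] intro: exI[of _ "{_}"])
qed simp

lemma cheeger_constant_finite:
  assumes "finite (verts \<Gamma>)" "verts \<Gamma> \<noteq> {}"
  shows "cheeger_constant \<Gamma> = 0"
  using cheeger_constant_le[of "verts \<Gamma>" \<Gamma>] cheeger_constant_nonneg[of \<Gamma>] assms
  by (simp add: vertex_boundary_def)

text \<open>The cosets \<open>H a^k\<close> with \<open>k > K\<close> form a ray whose vertices carry loops labelled \<open>b\<close>.\<close>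

lemma (in group) cheeger_constant_schreier_ray:
  assumes H: "subgroup H G" and a: "a \<in> carrier G" and b: "b \<in> carrier G"
    and inj: "inj (\<lambda>k::nat. H #> a [^] k)"
    and loop: "\<And>k. k \<ge> K \<Longrightarrow> H #> a [^] (k::nat) #> b = H #> a [^] k"
  shows "cheeger_constant (schreier_graph G {a, b} H) = 0"
proof (rule antisym)
  let ?\<Gamma> = "schreier_graph G {a, b} H"
  define c where "c k = H #> a [^] k" for k :: nat
  have V: "verts ?\<Gamma> = rcosets H" by (simp add: schreier_graph_def)
  have cV: "c k \<in> rcosets H" for k
    using H a by (simp add: c_def rcosetsI subgroup.subset)
  have cC: "c k \<subseteq> carrier G" for k using rcosets_subset_carrier[OF H cV] .
  have ca: "c k #> a = c (Suc k)" for k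
    using a H by (simp add: c_def coset_mult_assoc subgroup.subset)
  have cb: "c k #> b = c k" if "k \<ge> K" for k
    using loop[OF that] by (simp add: c_def)
  have le: "cheeger_constant ?\<Gamma> \<le> 2 / real n" if n: "n > 0" for n
  proof -
    \<comment> \<open>Starting at \<open>K + 1\<close> rather than \<open>K\<close> makes every
      index in the segment positive, so \<open>k - 1\<close> is a true predecessor.\<close>
    let ?A = "c ` {K + 1..<K + 1 + n}"
    have "vertex_boundary ?\<Gamma> ?A \<subseteq> {c K, c (K + 1 + n)}"
    proof
      fix v assume "v \<in> vertex_boundary ?\<Gamma> ?A"
      then obtain k where v: "v \<in> rcosets H" "v \<notin> ?A" and k: "K + 1 \<le> k" "k < K + 1 + n"
        and e: "(c k, v) \<in> arcs_ends ?\<Gamma> \<or> (v, c k) \<in> arcs_ends ?\<Gamma>"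
        by (auto simp: vertex_boundary_def V)
      have ck: "c k \<in> ?A" using k by auto
      from e have "\<exists>s. (s = a \<or> s = b) \<and> (v = c k #> s \<or> c k = v #> s)"
        unfolding arcs_ends_def arc_to_ends_def schreier_graph_def by fastforce
      then obtain s where s: "s = a \<or> s = b" "v = c k #> s \<or> c k = v #> s" by blast
      have vC: "v \<subseteq> carrier G" using rcosets_subset_carrier[OF H v(1)] .
      have "v = c (Suc k) \<or> v = c (k - 1) \<or> v = c k"
      proof (cases "v = c k #> s")
        case True
        then show ?thesis using s ca cb k by auto
      next
        case False
        then have e: "v #> s = c k" using s by auto
        \<comment> \<open>An arc into \<open>c k\<close> labelled \<open>a\<close> or
          \<open>b\<close> is compared with the known arc of the same label; cancelling the label
          identifies their starting points.\<close>
        have "c (k - 1) #> a = c k" "c k #> b = c k" using ca[of "k - 1"] cb k by auto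
        then show ?thesis
          using s r_coset_cancel[OF vC _ e] r_coset_cancel[OF cC] a b by metis
      qed
      moreover have "c (Suc k) \<in> ?A \<or> Suc k = K + 1 + n" using k by auto
      \<comment> \<open>Since \<open>v\<close> lies outside the segment, only its two outer
        neighbours remain.\<close>
      moreover have "c (k - 1) \<in> ?A \<or> k - 1 = K" using k
        by (intro disjCI imageI) (simp, linarith)
      ultimately show "v \<in> {c K, c (K + 1 + n)}" using v ck by auto
    qed
    then have "card (vertex_boundary ?\<Gamma> ?A) \<le> card {c K, c (K + 1 + n)}"
      by (intro card_mono) auto
    also have "\<dots> \<le> 2" by (simp add: card_insert_if)
    finally have b2: "card (vertex_boundary ?\<Gamma> ?A) \<le> 2" .
    have "inj c" using inj unfolding c_def .
    then have "card ?A = n" by (simp add: card_image inj_on_subset[of c UNIV])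
    then have "cheeger_constant ?\<Gamma> \<le> real (card (vertex_boundary ?\<Gamma> ?A)) / real n"
      using cheeger_constant_le[of ?A ?\<Gamma>] cV n V by auto
    also have "\<dots> \<le> 2 / real n" using b2 by (intro divide_right_mono) auto
    finally show ?thesis .
  qed
  have "(\<lambda>n. 2 / real n) \<longlonglongrightarrow> 0" by (rule lim_const_over_n)
  then show "cheeger_constant ?\<Gamma> \<le> 0"
    by (rule LIMSEQ_le_const) (use le in \<open>auto intro!: exI[of _ 1]\<close>)
  show "0 \<le> cheeger_constant ?\<Gamma>"
    using cheeger_constant_nonneg[of ?\<Gamma>] cV V by blast
qed

section \<open>Stabilizers\<close>

text \<open>Elements of the group are \<open>undefined\<close> outside the unit interval, so the
  identity is sure to fix the points of \<open>A\<close> only if they lie inside.\<close>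

lemma subgroup_Stab_F:
  assumes "A \<subseteq> {0..1}"
  shows "subgroup (Stab_F A) thompson_F"
proof -
  interpret group thompson_F by (rule group_thompson_F)
  show ?thesis
  proof (rule subgroupI)
    show "Stab_F A \<noteq> {}"
      using assms one_closed by (auto simp: Stab_F_def one_thompson_F subset_iff intro!: exI[of _ "\<one>\<^bsub>thompson_F\<^esub>"])
  next
    fix f assume f: "f \<in> Stab_F A"
    then have fF: "f \<in> carrier thompson_F" by (simp add: Stab_F_def)
    have "(inv\<^bsub>thompson_F\<^esub> f) d = d" if "d \<in> A" for d
    proof -
      have "(f \<otimes>\<^bsub>thompson_F\<^esub> inv\<^bsub>thompson_F\<^esub> f) d = d"
        using that assms fF by (auto simp: one_thompson_F)
      then show ?thesis using that assms f by (auto simp: mult_thompson_F compose_def Stab_F_def)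
    qed
    then show "inv\<^bsub>thompson_F\<^esub> f \<in> Stab_F A" using fF by (simp add: Stab_F_def)
  next
    fix f g assume "f \<in> Stab_F A" "g \<in> Stab_F A"
    then show "f \<otimes>\<^bsub>thompson_F\<^esub> g \<in> Stab_F A"
      using assms m_closed[of f g] by (auto simp: Stab_F_def mult_thompson_F compose_def subset_iff)
  qed (auto simp: Stab_F_def)
qed

text \<open>The product of \<open>f\<close> with the inverse of \<open>g\<close> applies
  \<open>f\<close> first, so it fixes \<open>d\<close> when \<open>f\<close> and \<open>g\<close>
  agree at \<open>d\<close>. Cosets thus become placements of the points of \<open>A\<close>, and
  the Schreier graph records how the generators move them.\<close>

lemma Stab_F_coset_eq_iff:
  assumes A: "A \<subseteq> {0..1}" and f: "f \<in> carrier thompson_F" and g: "g \<in> carrier thompson_F"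
  shows "Stab_F A #>\<^bsub>thompson_F\<^esub> f = Stab_F A #>\<^bsub>thompson_F\<^esub> g \<longleftrightarrow> (\<forall>d\<in>A. f d = g d)"
proof -
  interpret group thompson_F by (rule group_thompson_F)
  have H: "subgroup (Stab_F A) thompson_F" using A by (rule subgroup_Stab_F)
  show ?thesis
  proof
    assume "Stab_F A #>\<^bsub>thompson_F\<^esub> f = Stab_F A #>\<^bsub>thompson_F\<^esub> g"
    then have "f \<in> Stab_F A #>\<^bsub>thompson_F\<^esub> g" using rcos_self[OF f H] by simp
    then obtain h where "h \<in> Stab_F A" "f = h \<otimes>\<^bsub>thompson_F\<^esub> g" by (auto simp: r_coset_def)
    then show "\<forall>d\<in>A. f d = g d"
      using A by (auto simp: Stab_F_def mult_thompson_F compose_def subset_iff)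
  next
    assume e: "\<forall>d\<in>A. f d = g d"
    let ?h = "f \<otimes>\<^bsub>thompson_F\<^esub> inv\<^bsub>thompson_F\<^esub> g"
    have "?h d = d" if "d \<in> A" for d
    proof -
      have "?h d = (g \<otimes>\<^bsub>thompson_F\<^esub> inv\<^bsub>thompson_F\<^esub> g) d"
        using that e A by (auto simp: mult_thompson_F compose_def)
      then show ?thesis using that A g by (auto simp: one_thompson_F)
    qed
    then have "?h \<in> Stab_F A" using f g by (simp add: Stab_F_def)
    then show "Stab_F A #>\<^bsub>thompson_F\<^esub> f = Stab_F A #>\<^bsub>thompson_F\<^esub> g"
      using coset_join2[OF _ H] coset_mult_inv1[OF _ f g subgroup.subset[OF H]] f g by simp
  qed
qed

section \<open>Orbits under the powers of \<open>x0\<close>\<close>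

lemma x0_pow_Suc:
  "d \<in> {0..1} \<Longrightarrow> (x0 [^]\<^bsub>thompson_F\<^esub> Suc k) d = x0 ((x0 [^]\<^bsub>thompson_F\<^esub> k) d)"
  by (simp add: nat_pow_Suc mult_thompson_F compose_def)

text \<open>A point above 1/2 moves left by 1/4 on the middle piece and by its distance to 1 on the
  last piece. Both are at least the minimum in the bound, and once at or below 1/2 the orbit stays
  there.\<close>

lemma x0_pow_bounds:
  assumes d: "0 < d" "d < 1"
  shows "0 < (x0 [^]\<^bsub>thompson_F\<^esub> (k::nat)) d \<and> (x0 [^]\<^bsub>thompson_F\<^esub> k) d < 1 \<and>
    (x0 [^]\<^bsub>thompson_F\<^esub> k) d \<le> max (1/2) (d - real k * min (1/4) (1 - d))"
proof (induction k)
  case 0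
  then show ?case using d by (simp add: nat_pow_0 one_thompson_F)
next
  case (Suc k)
  define m t where "m = min (1/4) (1 - d)" and "t = (x0 [^]\<^bsub>thompson_F\<^esub> k) d"
  have m: "0 < m" "m \<le> 1/4" "m \<le> 1 - d" using d by (simp_all add: m_def min_def)
  then have km: "0 \<le> real k * m" by simp
  have t: "0 < t" "t < 1" "t \<le> max (1/2) (d - real k * m)"
    using Suc by (auto simp: m_def t_def)
  \<comment> \<open>The orbit never exceeds the larger of 1/2 and \<open>d\<close>, so its distance
    to 1 stays at least \<open>m\<close>.\<close>
  then have td: "t \<le> max (1/2) d" using km by linarith
  have "0 < x0 t \<and> x0 t < 1 \<and> x0 t \<le> max (1/2) (d - (real k * m + m))"
    using t m td unfolding x0_def max_def by (auto split: if_splits)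
  then show ?case
    using d x0_pow_Suc[of d k] by (simp add: m_def t_def algebra_simps)
qed

lemma x0_pow_strict_antimono:
  assumes d: "0 < d" "d < 1" and "j < k"
  shows "(x0 [^]\<^bsub>thompson_F\<^esub> (k::nat)) d < (x0 [^]\<^bsub>thompson_F\<^esub> (j::nat)) d"
proof -
  have "x0 t < t" if "0 < t" "t < 1" for t using that by (auto simp: x0_def)
  then have "(x0 [^]\<^bsub>thompson_F\<^esub> Suc k) d < (x0 [^]\<^bsub>thompson_F\<^esub> k) d" for k
    using x0_pow_Suc[of d k] x0_pow_bounds[OF d, of k] d by simp
  \<comment> \<open>The sign is reversed because \<open>lift_Suc_mono_less\<close> concerns
    increasing sequences.\<close>
  then have "- (x0 [^]\<^bsub>thompson_F\<^esub> j) d < - (x0 [^]\<^bsub>thompson_F\<^esub> k) d"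
    using \<open>j < k\<close> by (rule_tac lift_Suc_mono_less[of "\<lambda>k. - (x0 [^]\<^bsub>thompson_F\<^esub> k) d"]) simp_all
  then show ?thesis by simp
qed

text \<open>Phrased with \<open>eventually\<close> so that the thresholds for the finitely many
  points of \<open>A\<close> combine into one.\<close>

lemma x0_pow_eventually_small:
  assumes d: "0 < d" "d < 1"
  shows "eventually (\<lambda>k. (x0 [^]\<^bsub>thompson_F\<^esub> (k::nat)) d \<le> 1/2) sequentially"
proof -
  define m where "m = min (1/4) (1 - d)"
  have m: "0 < m" using d by (simp add: m_def)
  obtain n where n: "1 < real n * m" using reals_Archimedean3[OF m] by blast
  have "(x0 [^]\<^bsub>thompson_F\<^esub> k) d \<le> 1/2" if "k \<ge> n" for k
  proof -
    have "real n * m \<le> real k * m" using that m by simp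
    then show ?thesis using x0_pow_bounds[OF d, of k] n d by (auto simp: m_def[symmetric])
  qed
  then show ?thesis by (auto simp: eventually_sequentially)
qed

theorem proposition3:
  fixes A :: "real set"
  assumes "finite A" and "A \<subseteq> dyadics \<inter> {0<..<1}"
  shows "coamenable_wrt thompson_F {x0, x1} (Stab_F A)"
proof -
  interpret group thompson_F by (rule group_thompson_F)
  have A: "A \<subseteq> {0..1}" "\<And>d. d \<in> A \<Longrightarrow> 0 < d \<and> d < 1" using assms(2) by auto
  note H = subgroup_Stab_F[OF A(1)]
  have pow: "x0 [^]\<^bsub>thompson_F\<^esub> k \<in> carrier thompson_F" for k :: nat
    using x0_in_thompson_F by simp
  have "cheeger_constant (schreier_graph thompson_F {x0, x1} (Stab_F A)) = 0"
  \<comment> \<open>With no points to fix, the stabilizer is the whole group and the graph has one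
    vertex, so there is no ray.\<close>
  proof (cases "A = {}")
    case True
    then have "Stab_F A = carrier thompson_F" by (auto simp: Stab_F_def)
    then have "rcosets\<^bsub>thompson_F\<^esub> (Stab_F A) = {carrier thompson_F}"
      using coset_join2[OF _ subgroup_self] by (auto simp: RCOSETS_def)
    then show ?thesis
      by (intro cheeger_constant_finite) (simp_all add: schreier_graph_def)
  next
    case False
    \<comment> \<open>A single point separates the cosets, because its orbit is strictly
      decreasing.\<close>
    then obtain d where d: "d \<in> A" by blast
    have "inj (\<lambda>k::nat. Stab_F A #>\<^bsub>thompson_F\<^esub> x0 [^]\<^bsub>thompson_F\<^esub> k)"
    proof (rule injI)
      fix j k :: nat
      assume "Stab_F A #>\<^bsub>thompson_F\<^esub> x0 [^]\<^bsub>thompson_F\<^esub> j = Stab_F A #>\<^bsub>thompson_F\<^esub> x0 [^]\<^bsub>thompson_F\<^esub> k"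
      then have "(x0 [^]\<^bsub>thompson_F\<^esub> j) d = (x0 [^]\<^bsub>thompson_F\<^esub> k) d"
        using Stab_F_coset_eq_iff[OF A(1) pow pow] d by blast
      then show "j = k"
        using x0_pow_strict_antimono[of d j k] x0_pow_strict_antimono[of d k j] A(2)[OF d]
        by (metis less_irrefl linorder_neqE_nat)
    qed
    moreover have "eventually (\<lambda>k. \<forall>d\<in>A. (x0 [^]\<^bsub>thompson_F\<^esub> (k::nat)) d \<le> 1/2) sequentially"
      using assms(1) A(2) by (intro eventually_ball_finite ballI x0_pow_eventually_small) auto
    then obtain K where K: "\<And>k d. k \<ge> K \<Longrightarrow> d \<in> A \<Longrightarrow> (x0 [^]\<^bsub>thompson_F\<^esub> (k::nat)) d \<le> 1/2"
      by (auto simp: eventually_sequentially)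
    have "Stab_F A #>\<^bsub>thompson_F\<^esub> x0 [^]\<^bsub>thompson_F\<^esub> k #>\<^bsub>thompson_F\<^esub> x1
        = Stab_F A #>\<^bsub>thompson_F\<^esub> x0 [^]\<^bsub>thompson_F\<^esub> k" if "k \<ge> K" for k
    proof -
      \<comment> \<open>Here every point of \<open>A\<close> has to be at most 1/2, where
        \<open>x1\<close> is the identity.\<close>
      have "(x0 [^]\<^bsub>thompson_F\<^esub> k \<otimes>\<^bsub>thompson_F\<^esub> x1) d = (x0 [^]\<^bsub>thompson_F\<^esub> k) d" if "d \<in> A" for d
        using K[OF \<open>k \<ge> K\<close> that] A(2)[OF that] x0_pow_bounds[of d k]
        by (simp add: mult_thompson_F compose_def x1_def)
      then have "Stab_F A #>\<^bsub>thompson_F\<^esub> (x0 [^]\<^bsub>thompson_F\<^esub> k \<otimes>\<^bsub>thompson_F\<^esub> x1)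
          = Stab_F A #>\<^bsub>thompson_F\<^esub> x0 [^]\<^bsub>thompson_F\<^esub> k"
        using Stab_F_coset_eq_iff[OF A(1) m_closed[OF pow x1_in_thompson_F] pow] by blast
      then show ?thesis
        using coset_mult_assoc[OF subgroup.subset[OF H] pow x1_in_thompson_F] by simp
    qed
    ultimately show ?thesis
      using cheeger_constant_schreier_ray[OF H x0_in_thompson_F x1_in_thompson_F] by blast
  qed
  then show ?thesis
    using group_thompson_F H x0_in_thompson_F x1_in_thompson_F bounded_degree_schreier_graph[OF H]
    by (simp add: coamenable_wrt_def amenable_graph_def)
qed

end
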